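(* Let $m$ be a complex number, $x$ an indeterminate, and let $\mathcal{A}_m(n,x)=\sum_{k=0}^n k!\,W_m(n,k)(x-1)^{n-k}$ be the Eulerian-Dowling polynomials. Then, as formal power series in $z$, $$\sum_{n=0}^{\infty}\mathcal{A}_m(n,x)z^n=\cfrac{1}{1-b_0z-\cfrac{\lambda_1z^2}{1-b_1z-\cfrac{\lambda_2z^2}{1-b_2z-\cfrac{\lambda_3z^2}{1-b_3z-\cdots}}}},$$ where $b_n=x(nm+1)-n(m-2)$ for $n\ge 0$ and $\lambda_n=n^2(m(x-1)+1)$ for $n\ge 1$. In particular, the Hankel transform $h_n=\det\big(\mathcal{A}_m(i+j,x)\big)_{0\le i,j\le n}$ of the sequence $(\mathcal{A}_m(n,x))_{n\ge 0}$ is, for all $n\ge 0$, $$h_n=(m(x-1)+1)^{\binom{n+1}{2}}\prod_{k=0}^n k!^2.$$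
   Context: The Whitney numbers of the second kind of Dowling lattices are $W_m(n,k)=\sum_{i=k}^n\binom{n}{i}m^{i-k}S(i,k)$ (with $0^0=1$), where $S(i,k)$ are the Stirling numbers of the second kind; for $m\ne 0$ this is equivalent to $\sum_{n\ge 0} W_m(n,k)\frac{z^n}{n!}=\frac{e^z}{m^k k!}(e^{mz}-1)^k$, and $W_0(n,k)=\binom{n}{k}$. The infinite continued fraction denotes the limit, in the $z$-adic topology on $\mathbb{C}[x][[z]]$, of its finite truncations. The Hankel transform of a sequence $(a_n)_{n\ge 0}$ is the sequence of determinants $h_n=\det(a_{i+j})_{0\le i,j\le n}$. *)

theory Defs
  imports
    Complex_Main
    "HOL-Combinatorics.Stirling"
    "HOL-Computational_Algebra.Polynomial"
    "HOL-Computational_Algebra.Formal_Power_Series"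
    "Jordan_Normal_Form.Determinant"
begin

definition dowling_whitney :: "'a::comm_ring_1 \<Rightarrow> nat \<Rightarrow> nat \<Rightarrow> 'a" where
  "dowling_whitney m n k = (\<Sum>i=k..n. of_nat (n choose i) * m ^ (i - k) * of_nat (Stirling i k))"

(* The indeterminate x is the polynomial [:0, 1:], and complex numbers are embedded as
   constant polynomials [:c:]. *)

definition eulerian_dowling :: "complex \<Rightarrow> nat \<Rightarrow> complex poly" where
  "eulerian_dowling m n =
     (\<Sum>k=0..n. of_nat (fact k) * [:dowling_whitney m n k:] * ([:0, 1:] - 1) ^ (n - k))"

(* The class-based inverse on fps needs an inverse on the coefficients, which complex poly
   does not have; fps_right_inverse F 1 is the inverse of F when F has constant term 1. *)

definition fps_recip :: "'a::comm_ring_1 fps \<Rightarrow> 'a fps" where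
  "fps_recip F = fps_right_inverse F 1"

lemma fps_recip_mult:
  fixes F :: "'a::comm_ring_1 fps"
  assumes "fps_nth F 0 = 1"
  shows "F * fps_recip F = 1"
  unfolding fps_recip_def by (rule fps_right_inverse) (simp add: assms)

(* jfraction_trunc b l N k is
   1 / (1 - b k z - l (k+1) z^2 / (1 - b (k+1) z - ... - l (k+N) z^2 / (1 - b (k+N) z))).
   All denominators have constant term 1. *)

fun jfraction_trunc ::
  "(nat \<Rightarrow> 'a::comm_ring_1) \<Rightarrow> (nat \<Rightarrow> 'a) \<Rightarrow> nat \<Rightarrow> nat \<Rightarrow> 'a fps" where
  "jfraction_trunc b l 0 k = fps_recip (1 - fps_const (b k) * fps_X)"
| "jfraction_trunc b l (Suc N) k =
     fps_recip (1 - fps_const (b k) * fps_X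
       - fps_const (l (Suc k)) * fps_X ^ 2 * jfraction_trunc b l N (Suc k))"

(* Convergence is in the metric of the type fps, which induces the z-adic topology
   (discrete on coefficients). *)

definition has_jfraction ::
  "'a::comm_ring_1 fps \<Rightarrow> (nat \<Rightarrow> 'a) \<Rightarrow> (nat \<Rightarrow> 'a) \<Rightarrow> bool" where
  "has_jfraction F b l \<longleftrightarrow> (\<lambda>N. jfraction_trunc b l N 0) \<longlonglongrightarrow> F"

definition hankel_transform :: "(nat \<Rightarrow> 'a::comm_ring_1) \<Rightarrow> nat \<Rightarrow> 'a" where
  "hankel_transform a n = det (mat (n + 1) (n + 1) (\<lambda>(i, j). a (i + j)))"

end

(* The J-fraction with coefficients b, l is the generating function of weighted Motzkin paths:
   splitting paths at the last visit to the ground level gives the continued fraction, and the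
   Stieltjes matrix A(n,k) of paths ending at height k factors the Hankel matrix as A D A^T with
   A unitriangular and D diagonal. For the given b, l the column generating functions
   sum_n A(n,k) z^n/n! are g f^k / k! with g'/g = b_0 + c f and f' = (1 + f)(1 + c f), where
   y = x - 1 and c = m y + 1. With h = (exp(m y z) - 1)/(m y), the solution is f = h/(1 - h),
   g = exp(y z)/(1 - h), so that g is the exponential generating function of the
   Eulerian-Dowling polynomials. Expanding g f^k in powers of h gives
   k! A(n,k) = sum_j binomial(j,k) j! W_m(n,j) y^(n-j), which is verified by its recurrence. *)

theory Submission
  imports Defs
begin

section \<open>Weighted Motzkin paths\<close>

text \<open>\<^term>\<open>motzkin b l s n k\<close> is the total weight of the paths of length \<open>n\<close> from height \<open>s\<close> to
  height \<open>s + k\<close> that stay at or above \<open>s\<close>, where a level step at height \<open>i\<close> has weight \<open>b i\<close> and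
  a down step from height \<open>i\<close> has weight \<open>l i\<close>. The recursion removes the last step.\<close>

fun motzkin :: "(nat \<Rightarrow> 'a::comm_ring_1) \<Rightarrow> (nat \<Rightarrow> 'a) \<Rightarrow> nat \<Rightarrow> nat \<Rightarrow> nat \<Rightarrow> 'a" where
  "motzkin b l s 0 0 = 1"
| "motzkin b l s 0 (Suc k) = 0"
| "motzkin b l s (Suc n) 0 = b s * motzkin b l s n 0 + l (Suc s) * motzkin b l s n 1"
| "motzkin b l s (Suc n) (Suc k) = motzkin b l s n k
     + b (s + Suc k) * motzkin b l s n (Suc k)
     + l (Suc (s + Suc k)) * motzkin b l s n (Suc (Suc k))"

lemma motzkin_eq_0: "n < k \<Longrightarrow> motzkin b l s n k = 0"
  by (induction b l s n k rule: motzkin.induct) auto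

lemma motzkin_diag: "motzkin b l s n n = 1"
  by (induction n) (auto simp: motzkin_eq_0)

section \<open>Generating functions of paths by final height\<close>

definition motzkin_fps :: "(nat \<Rightarrow> 'a::comm_ring_1) \<Rightarrow> (nat \<Rightarrow> 'a) \<Rightarrow> nat \<Rightarrow> nat \<Rightarrow> 'a fps" where
  "motzkin_fps b l s k = Abs_fps (\<lambda>n. motzkin b l s n k)"

lemma motzkin_fps_0:
  "motzkin_fps b l s 0 = 1 + fps_X * (fps_const (b s) * motzkin_fps b l s 0
     + fps_const (l (Suc s)) * motzkin_fps b l s 1)"
proof (rule fps_ext)
  fix n show "fps_nth (motzkin_fps b l s 0) n = fps_nth (1 + fps_X * (fps_const (b s) * motzkin_fps b l s 0
     + fps_const (l (Suc s)) * motzkin_fps b l s 1)) n"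
    by (cases n) (simp_all add: motzkin_fps_def)
qed

lemma motzkin_fps_Suc:
  "motzkin_fps b l s (Suc k) = fps_X * (motzkin_fps b l s k
     + fps_const (b (s + Suc k)) * motzkin_fps b l s (Suc k)
     + fps_const (l (Suc (s + Suc k))) * motzkin_fps b l s (Suc (Suc k)))"
proof (rule fps_ext)
  fix n show "fps_nth (motzkin_fps b l s (Suc k)) n = fps_nth (fps_X * (motzkin_fps b l s k
     + fps_const (b (s + Suc k)) * motzkin_fps b l s (Suc k)
     + fps_const (l (Suc (s + Suc k))) * motzkin_fps b l s (Suc (Suc k)))) n"
    by (cases n) (simp_all add: motzkin_fps_def)
qed

text \<open>The factor \<open>fps_X\<close> makes each coefficient depend only on lower ones at
  neighbouring heights, so induction on the degree kills all \<open>D k\<close> at once. This gives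
  uniqueness for the path equations.\<close>

lemma tridiagonal_fps_eq_0:
  fixes D :: "nat \<Rightarrow> 'a::comm_ring_1 fps"
  assumes "\<And>k. D k = fps_X * ((if k = 0 then 0 else D (k - 1))
             + fps_const (c k) * D k + fps_const (d k) * D (Suc k))"
  shows "D k = 0"
proof -
  have "fps_nth (D k) n = 0" for n
  proof (induction n arbitrary: k)
    case 0
    show ?case by (subst assms) simp
  next
    case (Suc n)
    show ?case by (subst assms) (simp add: Suc.IH)
  qed
  then show ?thesis by (simp add: fps_eq_iff)
qed

text \<open>Split a path at its last visit to its starting height.\<close>

lemma motzkin_fps_last_visit:
  "motzkin_fps b l s (Suc k) = fps_X * motzkin_fps b l s 0 * motzkin_fps b l (Suc s) k"
proof -
  define D where
    "D k = motzkin_fps b l s (Suc k) - fps_X * motzkin_fps b l s 0 * motzkin_fps b l (Suc s) k" for k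
  \<comment> \<open>At \<open>k = 0\<close> the empty path from \<open>Suc s\<close>, multiplied by
    \<open>fps_X * motzkin_fps b l s 0\<close>, cancels the step up from height \<open>s\<close>;
    hence the zero boundary term.\<close>
  have "D k = fps_X * ((if k = 0 then 0 else D (k - 1))
             + fps_const (b (s + Suc k)) * D k + fps_const (l (Suc (s + Suc k))) * D (Suc k))" for k
  proof -
    let ?G = "fps_X * motzkin_fps b l s 0"
    have tail: "motzkin_fps b l (Suc s) k = (if k = 0 then 1 else fps_X * motzkin_fps b l (Suc s) (k - 1))
        + fps_X * (fps_const (b (s + Suc k)) * motzkin_fps b l (Suc s) k
                   + fps_const (l (Suc (s + Suc k))) * motzkin_fps b l (Suc s) (Suc k))"
      using motzkin_fps_0[of b l "Suc s"] motzkin_fps_Suc[of b l "Suc s" "k - 1"]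
      by (cases k) (simp_all add: distrib_left add.assoc)
    have "D k = fps_X * (motzkin_fps b l s k
           + fps_const (b (s + Suc k)) * motzkin_fps b l s (Suc k)
           + fps_const (l (Suc (s + Suc k))) * motzkin_fps b l s (Suc (Suc k)))
         - ?G * ((if k = 0 then 1 else fps_X * motzkin_fps b l (Suc s) (k - 1))
        + fps_X * (fps_const (b (s + Suc k)) * motzkin_fps b l (Suc s) k
                   + fps_const (l (Suc (s + Suc k))) * motzkin_fps b l (Suc s) (Suc k)))"
      unfolding D_def
      by (rule arg_cong2[of _ _ _ _ minus, OF motzkin_fps_Suc arg_cong[OF tail]])
    then show ?thesis
      by (cases k) (simp_all add: D_def algebra_simps)
  qed
  then have "D k = 0" by (rule tridiagonal_fps_eq_0)
  then show ?thesis by (simp add: D_def)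
qed

section \<open>The continued fraction and its truncations\<close>

lemma motzkin_fps_recip:
  "(1 - fps_const (b s) * fps_X - fps_const (l (Suc s)) * fps_X ^ 2 * motzkin_fps b l (Suc s) 0)
     * motzkin_fps b l s 0 = 1"
proof -
  have "motzkin_fps b l s 0 = 1 + fps_X * (fps_const (b s) * motzkin_fps b l s 0
     + fps_const (l (Suc s)) * (fps_X * motzkin_fps b l s 0 * motzkin_fps b l (Suc s) 0))"
    using motzkin_fps_0[of b l s] motzkin_fps_last_visit[of b l s 0] by simp
  then show ?thesis by (simp add: algebra_simps power2_eq_square)
qed

text \<open>A difference of reciprocals is \<open>J - M = J * M * (Q - P)\<close>, and
  \<open>Q - P\<close> contains \<open>fps_X ^ 2\<close> times the error one level deeper; gaining
  one \<open>fps_X\<close> per level is enough for convergence.\<close>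

lemma jfraction_trunc_approx:
  "fps_X ^ N dvd jfraction_trunc b l N s - motzkin_fps b l s 0"
proof (induction N arbitrary: s)
  case 0
  show ?case by simp
next
  case (Suc N)
  define J M J' M' where "J = jfraction_trunc b l (Suc N) s" and "M = motzkin_fps b l s 0"
    and "J' = jfraction_trunc b l N (Suc s)" and "M' = motzkin_fps b l (Suc s) 0"
  define P Q where
    "P = 1 - fps_const (b s) * fps_X - fps_const (l (Suc s)) * fps_X ^ 2 * J'"
    and "Q = 1 - fps_const (b s) * fps_X - fps_const (l (Suc s)) * fps_X ^ 2 * M'"
  have PJ: "P * J = 1"
    using fps_recip_mult[of P] by (simp add: J_def P_def J'_def power2_eq_square)
  have QM: "Q * M = 1"
    unfolding Q_def M_def M'_def by (rule motzkin_fps_recip)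
  have "J - M = J * (Q * M) - (P * J) * M"
    by (simp add: PJ QM)
  also have "\<dots> = J * M * (Q - P)"
    by (simp add: algebra_simps)
  also have "Q - P = fps_const (l (Suc s)) * fps_X ^ 2 * (J' - M')"
    by (simp add: P_def Q_def algebra_simps)
  also have "J * M * \<dots> = (fps_X * (J' - M')) * (J * M * fps_const (l (Suc s)) * fps_X)"
    by (simp add: power2_eq_square mult_ac)
  finally have "J - M = (fps_X * (J' - M')) * (J * M * fps_const (l (Suc s)) * fps_X)" .
  moreover have "fps_X ^ Suc N dvd fps_X * (J' - M')"
    using Suc.IH[of "Suc s"] by (simp add: J'_def M'_def mult_dvd_mono)
  ultimately show ?case
    by (metis J_def M_def dvd_mult2)
qed

theorem has_jfraction_motzkin: "has_jfraction (Abs_fps (\<lambda>n. motzkin b l 0 n 0)) b l"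
  unfolding has_jfraction_def tendsto_fps_iff
proof
  fix n
  have "fps_nth (jfraction_trunc b l N 0) n = fps_nth (Abs_fps (\<lambda>n. motzkin b l 0 n 0)) n"
    if "N > n" for N
  proof -
    obtain g where "jfraction_trunc b l N 0 - motzkin_fps b l 0 0 = fps_X ^ N * g"
      using jfraction_trunc_approx by (metis dvdE)
    then have "fps_nth (jfraction_trunc b l N 0 - motzkin_fps b l 0 0) n = 0"
      using that by (simp add: fps_X_power_mult_nth)
    then show ?thesis by (simp add: motzkin_fps_def)
  qed
  then show "\<forall>\<^sub>F N in sequentially.
      fps_nth (jfraction_trunc b l N 0) n = fps_nth (Abs_fps (\<lambda>n. motzkin b l 0 n 0)) n"
    using eventually_gt_at_top[of n] by (rule eventually_mono[rotated])
qed

section \<open>Hankel determinants\<close>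

text \<open>The tridiagonal recursion operator is self-adjoint for the weights \<open>l 1 \<cdots> l k\<close>.\<close>

lemma motzkin_symmetric:
  assumes "i \<le> K" "j \<le> K"
  shows "(\<Sum>k\<le>K. motzkin b l 0 (Suc i) k * motzkin b l 0 j k * (\<Prod>p=1..k. l p))
       = (\<Sum>k\<le>K. motzkin b l 0 i k * motzkin b l 0 (Suc j) k * (\<Prod>p=1..k. l p))"
proof -
  define A where "A i k = motzkin b l 0 i k" for i k
  define L where "L k = (\<Prod>p=1..k. l p)" for k
  have L: "L (Suc k) = L k * l (Suc k)" for k
    by (simp add: L_def)
  have expand: "(\<Sum>k\<le>K. A (Suc i) k * A j k * L k)
      = (\<Sum>k<K. A i k * A j (Suc k) * L (Suc k)) + (\<Sum>k\<le>K. b k * A i k * A j k * L k)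
        + (\<Sum>k<K. A i (Suc k) * A j k * L (Suc k))" if "i \<le> K" for i j
  proof -
    have "A (Suc i) k = (if k = 0 then 0 else A i (k - 1)) + b k * A i k + l (Suc k) * A i (Suc k)" for k
      by (cases k) (simp_all add: A_def)
    then have "(\<Sum>k\<le>K. A (Suc i) k * A j k * L k)
       = (\<Sum>k\<le>K. (if k = 0 then 0 else A i (k - 1)) * A j k * L k)
         + (\<Sum>k\<le>K. b k * A i k * A j k * L k) + (\<Sum>k\<le>K. A i (Suc k) * A j k * L (Suc k))"
      by (simp add: L algebra_simps sum.distrib)
    also have "(\<Sum>k\<le>K. (if k = 0 then 0 else A i (k - 1)) * A j k * L k)
        = (\<Sum>k<K. A i k * A j (Suc k) * L (Suc k))"
      by (simp add: sum.atMost_shift)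
    \<comment> \<open>The top term drops out: a path of length \<open>i \<le> K\<close> cannot reach
      height \<open>Suc K\<close>.\<close>
    also have "(\<Sum>k\<le>K. A i (Suc k) * A j k * L (Suc k)) = (\<Sum>k<K. A i (Suc k) * A j k * L (Suc k))"
      using that by (simp add: lessThan_Suc_atMost[symmetric] A_def motzkin_eq_0)
    finally show ?thesis .
  qed
  \<comment> \<open>Swapping \<open>i\<close> and \<open>j\<close> exchanges the outer two sums of
    \<open>expand\<close> and fixes the middle one.\<close>
  have "(\<Sum>k\<le>K. A (Suc i) k * A j k * L k) = (\<Sum>k\<le>K. A (Suc j) k * A i k * L k)"
    unfolding expand[OF assms(1)] expand[OF assms(2)] by (simp add: mult_ac add_ac)
  then show ?thesis
    by (simp add: A_def L_def mult_ac)
qed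

text \<open>Self-adjointness moves steps one at a time from \<open>i\<close> to \<open>j\<close>
  until row \<open>0\<close> remains, which is supported at height \<open>0\<close>.\<close>

lemma motzkin_orthogonality:
  assumes "i + j \<le> K"
  shows "(\<Sum>k\<le>K. motzkin b l 0 i k * motzkin b l 0 j k * (\<Prod>p=1..k. l p)) = motzkin b l 0 (i + j) 0"
  using assms
proof (induction i arbitrary: j)
  case 0
  have "(\<Sum>k\<le>K. motzkin b l 0 0 k * motzkin b l 0 j k * (\<Prod>p=1..k. l p))
      = (\<Sum>k\<in>{0}. motzkin b l 0 0 k * motzkin b l 0 j k * (\<Prod>p=1..k. l p))"
    by (rule sum.mono_neutral_right) (auto simp: motzkin_eq_0)
  then show ?case by simp
next
  case (Suc i)
  then show ?case
    using Suc.IH[of "Suc j"] by (subst motzkin_symmetric) auto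
qed

theorem hankel_transform_motzkin:
  "hankel_transform (\<lambda>n. motzkin b l 0 n 0) n = (\<Prod>k=0..n. \<Prod>p=1..k. l p)"
proof -
  define A where "A = mat (n + 1) (n + 1) (\<lambda>(i, k). motzkin b l 0 i k)"
  define D where "D = mat (n + 1) (n + 1) (\<lambda>(k, k'). if k = k' then (\<Prod>p=1..k. l p) else 0)"
  have carrier: "A \<in> carrier_mat (n + 1) (n + 1)" "D \<in> carrier_mat (n + 1) (n + 1)"
    "A\<^sup>T \<in> carrier_mat (n + 1) (n + 1)" "A * D \<in> carrier_mat (n + 1) (n + 1)"
    by (auto simp: A_def D_def intro!: mult_carrier_mat)
  have AD: "(A * D) $$ (i, k) = motzkin b l 0 i k * (\<Prod>p=1..k. l p)" if "i \<le> n" "k \<le> n" for i k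
    using that by (simp add: A_def D_def scalar_prod_def sum.delta' if_distrib cong: if_cong)
  have "mat (n + 1) (n + 1) (\<lambda>(i, j). motzkin b l 0 (i + j) 0) = A * D * A\<^sup>T"
  proof (rule eq_matI)
    fix i j assume "i < dim_row (A * D * A\<^sup>T)" "j < dim_col (A * D * A\<^sup>T)"
    then have ij: "i \<le> n" "j \<le> n" by (simp_all add: A_def)
    have "(A * D * A\<^sup>T) $$ (i, j)
        = (\<Sum>k=0..<n + 1. (A * D) $$ (i, k) * A\<^sup>T $$ (k, j))"
      using ij carrier by (simp add: scalar_prod_def del: assoc_mult_mat)
    also have "\<dots> = (\<Sum>k\<le>n. motzkin b l 0 i k * motzkin b l 0 j k * (\<Prod>p=1..k. l p))"
      using ij by (intro sum.cong) (auto simp: AD, auto simp: A_def)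
    \<comment> \<open>The longer range meets the bound required for orthogonality; the added terms
      vanish since \<open>i \<le> n\<close>.\<close>
    also have "\<dots> = (\<Sum>k\<le>n + (i + j). motzkin b l 0 i k * motzkin b l 0 j k * (\<Prod>p=1..k. l p))"
      using ij by (intro sum.mono_neutral_left) (auto simp: motzkin_eq_0)
    also have "\<dots> = motzkin b l 0 (i + j) 0"
      by (rule motzkin_orthogonality) simp
    finally show "mat (n + 1) (n + 1) (\<lambda>(i, j). motzkin b l 0 (i + j) 0) $$ (i, j)
        = (A * D * A\<^sup>T) $$ (i, j)"
      using ij by simp
  qed (simp_all add: A_def)
  moreover have "det (A * D * A\<^sup>T) = det A * det D * det A"
    using carrier by (simp add: det_mult det_transpose)
  moreover have "det A = 1"
    by (subst det_lower_triangular[OF _ carrier(1)])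
       (auto simp: A_def prod_list_diag_prod motzkin_eq_0 motzkin_diag)
  moreover have "det D = (\<Prod>k=0..n. \<Prod>p=1..k. l p)"
    by (subst det_lower_triangular[OF _ carrier(2)])
       (auto simp: D_def prod_list_diag_prod atLeastLessThanSuc_atLeastAtMost)
  ultimately show ?thesis by (simp add: hankel_transform_def)
qed

section \<open>The Eulerian-Dowling polynomials\<close>

lemma dowling_whitney_eq_0: "n < k \<Longrightarrow> dowling_whitney m n k = 0"
  by (simp add: dowling_whitney_def)

lemma dowling_whitney_eq_sum:
  "dowling_whitney m n k = (\<Sum>i\<le>n. of_nat (n choose i) * (m ^ (i - k) * of_nat (Stirling i k)))"
  unfolding dowling_whitney_def
  by (rule sum.mono_neutral_cong_left) (auto simp: mult.assoc)

lemma dowling_whitney_pascal: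
  "dowling_whitney m (Suc n) k = dowling_whitney m n k
     + (\<Sum>i\<le>n. of_nat (n choose i) * (m ^ (Suc i - k) * of_nat (Stirling (Suc i) k)))"
proof -
  define w where "w i = m ^ (i - k) * of_nat (Stirling i k)" for i
  have "dowling_whitney m (Suc n) k = (\<Sum>i\<le>Suc n. of_nat (Suc n choose i) * w i)"
    by (simp only: dowling_whitney_eq_sum w_def)
  also have "\<dots> = w 0 + (\<Sum>i\<le>n. of_nat (n choose i) * w (Suc i)) + (\<Sum>i\<le>n. of_nat (n choose Suc i) * w (Suc i))"
    by (simp add: sum.atMost_Suc_shift sum.distrib algebra_simps del: sum.atMost_Suc)
  also have "(\<Sum>i\<le>n. of_nat (n choose Suc i) * w (Suc i)) = (\<Sum>i<n. of_nat (n choose Suc i) * w (Suc i))"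
    by (simp add: lessThan_Suc_atMost[symmetric] binomial_eq_0)
  finally have "dowling_whitney m (Suc n) k
      = (w 0 + (\<Sum>i<n. of_nat (n choose Suc i) * w (Suc i))) + (\<Sum>i\<le>n. of_nat (n choose i) * w (Suc i))"
    by (simp add: add_ac)
  also have "w 0 + (\<Sum>i<n. of_nat (n choose Suc i) * w (Suc i)) = dowling_whitney m n k"
    by (simp add: dowling_whitney_eq_sum w_def[symmetric] sum.atMost_shift)
  finally show ?thesis by (simp add: w_def)
qed

lemma dowling_whitney_Suc_0: "dowling_whitney m (Suc n) 0 = dowling_whitney m n 0"
  by (simp add: dowling_whitney_pascal)

lemma dowling_whitney_Suc_Suc:
  "dowling_whitney m (Suc n) (Suc k)
     = dowling_whitney m n k + (1 + m * of_nat (Suc k)) * dowling_whitney m n (Suc k)"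
proof -
  have "m ^ (i - k) * of_nat (Stirling (Suc i) (Suc k))
      = m ^ (i - k) * of_nat (Stirling i k)
        + m * of_nat (Suc k) * (m ^ (i - Suc k) * of_nat (Stirling i (Suc k)))" for i
  \<comment> \<open>For \<open>i \<le> k\<close> no factor \<open>m\<close> can be split off the
    truncated exponent, but then \<open>Stirling i (Suc k)\<close> vanishes.\<close>
  proof (cases "k < i")
    case True
    then have "m ^ (i - k) = m * m ^ (i - Suc k)"
      by (metis Suc_diff_Suc power_Suc)
    then show ?thesis by (simp add: algebra_simps)
  next
    case False
    then show ?thesis by simp
  qed
  then have "(\<Sum>i\<le>n. of_nat (n choose i) * (m ^ (i - k) * of_nat (Stirling (Suc i) (Suc k))))
      = dowling_whitney m n k + m * of_nat (Suc k) * dowling_whitney m n (Suc k)"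
    unfolding dowling_whitney_eq_sum sum_distrib_left sum.distrib[symmetric]
    by (intro sum.cong) (simp_all add: distrib_left mult_ac del: Stirling.simps of_nat_Suc)
  then show ?thesis
    by (simp add: dowling_whitney_pascal algebra_simps)
qed

text \<open>Formally the coefficient of z^n/n! in exp(y z) h^j, where h = (exp(m y z) - 1)/(m
  y).\<close>

definition ed_term :: "'a::comm_ring_1 \<Rightarrow> 'a \<Rightarrow> nat \<Rightarrow> nat \<Rightarrow> 'a" where
  "ed_term m y n j = of_nat (fact j) * dowling_whitney m n j * y ^ (n - j)"

text \<open>This is the derivative of exp(y z) h^(j+1), using h' = 1 + m y h.\<close>

lemma ed_term_Suc:
  assumes "j \<le> n"
  shows "ed_term m y (Suc n) (Suc j) = of_nat (Suc j) * ed_term m y n j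
           + (y + m * y * of_nat (Suc j)) * ed_term m y n (Suc j)"
proof (cases "j < n")
  case True
  then have "y ^ (n - j) = y * y ^ (n - Suc j)"
    by (metis Suc_diff_Suc power_Suc)
  then show ?thesis
    by (simp add: ed_term_def dowling_whitney_Suc_Suc algebra_simps)
next
  case False
  with assms show ?thesis
    by (simp add: ed_term_def dowling_whitney_Suc_Suc dowling_whitney_eq_0 algebra_simps)
qed

lemma ed_term_Suc_0: "ed_term m y (Suc n) 0 = y * ed_term m y n 0"
  by (simp add: ed_term_def dowling_whitney_Suc_0 algebra_simps)

lemma ed_term_eq_0: "n < j \<Longrightarrow> ed_term m y n j = 0"
  by (simp add: ed_term_def dowling_whitney_eq_0)

text \<open>The coefficient of \<open>z\<^sup>n / n!\<close> in \<open>g f\<^sup>k\<close>.\<close>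

definition ed_array :: "'a::comm_ring_1 \<Rightarrow> 'a \<Rightarrow> nat \<Rightarrow> nat \<Rightarrow> 'a" where
  "ed_array m y n k = (\<Sum>j\<le>n. of_nat (j choose k) * ed_term m y n j)"

text \<open>Regrouping by \<open>ed_term m y n j\<close> reduces recurrences of the array to
  binomial identities for each fixed \<open>j\<close>.\<close>

lemma ed_array_Suc:
  "ed_array m y (Suc n) k = (\<Sum>j\<le>n. (of_nat (Suc j choose k) * of_nat (Suc j)
       + of_nat (j choose k) * (y + m * y * of_nat j)) * ed_term m y n j)"
proof -
  define U where "U = ed_term m y"
  define c where "c j = (of_nat (j choose k) :: 'a)" for j
  define f where "f j = c j * (y + m * y * of_nat j) * U n j" for j
  have "ed_array m y (Suc n) k = c 0 * U (Suc n) 0 + (\<Sum>j\<le>n. c (Suc j) * U (Suc n) (Suc j))"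
    by (simp add: ed_array_def c_def U_def sum.atMost_Suc_shift del: sum.atMost_Suc)
  also have "(\<Sum>j\<le>n. c (Suc j) * U (Suc n) (Suc j))
      = (\<Sum>j\<le>n. c (Suc j) * of_nat (Suc j) * U n j) + (\<Sum>j\<le>n. f (Suc j))"
    unfolding sum.distrib[symmetric] U_def f_def
    by (intro sum.cong) (simp_all add: ed_term_Suc algebra_simps)
  also have "c 0 * U (Suc n) 0 = f 0"
    by (simp add: f_def U_def ed_term_Suc_0 mult_ac)
  also have "(\<Sum>j\<le>n. f (Suc j)) = (\<Sum>j<n. f (Suc j))"
    by (simp add: lessThan_Suc_atMost[symmetric] f_def U_def ed_term_eq_0)
  also have "f 0 + ((\<Sum>j\<le>n. c (Suc j) * of_nat (Suc j) * U n j) + (\<Sum>j<n. f (Suc j)))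
      = (\<Sum>j\<le>n. c (Suc j) * of_nat (Suc j) * U n j) + (\<Sum>j\<le>n. f j)"
    by (simp add: sum.atMost_shift)
  also have "\<dots> = (\<Sum>j\<le>n. (c (Suc j) * of_nat (Suc j) + c j * (y + m * y * of_nat j)) * U n j)"
    by (simp add: f_def algebra_simps sum.distrib)
  finally show ?thesis by (simp add: U_def c_def)
qed

lemma of_nat_choose_absorb:
  "of_nat (Suc k) * of_nat (j choose Suc k) = (of_nat j - of_nat k) * (of_nat (j choose k) :: 'a::comm_ring_1)"
proof (cases "k \<le> j")
  case True
  have "Suc k * (j choose Suc k) = (j - k) * (j choose k)"
    by (metis binomial_absorb_comp binomial_absorption)
  then have "(of_nat (Suc k * (j choose Suc k)) :: 'a) = of_nat ((j - k) * (j choose k))"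
    by (rule arg_cong)
  with True show ?thesis by (simp only: of_nat_mult of_nat_diff)
qed (simp add: binomial_eq_0)

lemma ed_array_recurrence_0:
  "ed_array m y (Suc n) 0 = (y + 1) * ed_array m y n 0 + (m * y + 1) * ed_array m y n 1"
  unfolding ed_array_Suc unfolding ed_array_def sum_distrib_left sum.distrib[symmetric]
  by (intro sum.cong) (simp_all add: algebra_simps)

text \<open>The coefficients are those of (g f^(k+1))', from g' = (y + 1 + c f) g and f' = (1 + f)(1
  + c f) with c = m y + 1.\<close>

lemma ed_array_recurrence_Suc:
  "ed_array m y (Suc n) (Suc k) = of_nat (Suc k) * ed_array m y n k
     + (y + 1 + of_nat (Suc k) * (m * y + 2)) * ed_array m y n (Suc k)
     + of_nat (Suc (Suc k)) * (m * y + 1) * ed_array m y n (Suc (Suc k))"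
proof -
  have "(of_nat (Suc j choose Suc k) * of_nat (Suc j)
       + of_nat (j choose Suc k) * (y + m * y * of_nat j))
     = of_nat (Suc k) * of_nat (j choose k)
       + (y + 1 + of_nat (Suc k) * (m * y + 2)) * of_nat (j choose Suc k)
       + of_nat (Suc (Suc k)) * (m * y + 1) * of_nat (j choose Suc (Suc k))" for j
  proof -
    define C C' C'' :: 'a where "C = of_nat (j choose k)" and "C' = of_nat (j choose Suc k)"
      and "C'' = of_nat (j choose Suc (Suc k))"
    define J K :: 'a where "J = of_nat j" and "K = of_nat k"
    have 1: "(K + 1) * C' = (J - K) * C"
      using of_nat_choose_absorb[of k j] by (simp add: C'_def C_def J_def K_def add.commute)
    have 2: "(K + 2) * C'' = (J - (K + 1)) * C'"
      using of_nat_choose_absorb[of "Suc k" j] by (simp add: C'_def C''_def J_def K_def add_ac)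
    have "(K + 2) * (m * y + 1) * C'' = (m * y + 1) * ((K + 2) * C'')"
      by (simp add: mult_ac)
    also have "\<dots> = (m * y + 1) * ((J - (K + 1)) * C')"
      by (simp only: 2)
    finally have 3: "(K + 2) * (m * y + 1) * C'' = (m * y + 1) * ((J - (K + 1)) * C')" .
    \<comment> \<open>Eliminating \<open>C''\<close> leaves a spare \<open>(K + 1) * C'\<close>;
      replacing it by \<open>(J - K) * C\<close> turns \<open>(K + 1) * C\<close> into
      \<open>(J + 1) * C\<close>.\<close>
    have "(K + 1) * C + (y + 1 + (K + 1) * (m * y + 2)) * C' + (K + 2) * (m * y + 1) * C''
        = (K + 1) * C + (K + 1) * C' + (y + J + 1 + m * y * J) * C'"
      unfolding 3 by (simp add: algebra_simps)
    also have "\<dots> = (C + C') * (J + 1) + C' * (y + m * y * J)"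
      unfolding 1 by (simp add: algebra_simps)
    finally show ?thesis
      by (simp add: C_def C'_def C''_def J_def K_def algebra_simps)
  qed
  then show ?thesis
    unfolding ed_array_Suc unfolding ed_array_def sum_distrib_left sum.distrib[symmetric]
    by (intro sum.cong) (simp_all add: algebra_simps del: of_nat_Suc binomial_Suc_Suc)
qed

text \<open>Scaling column \<open>k\<close> by k! splits the square in \<open>l\<close>: the up step
  gains the factor k, and k! (k+1)^2 = (k+1) (k+1)! leaves one factor k+1 on the down step. Both
  arrays then share recurrence and initial row.\<close>

lemma fact_motzkin_eq_ed_array:
  assumes b: "\<And>n. b n = y + 1 + of_nat n * (m * y + 2)"
    and l: "\<And>n. l n = of_nat n ^ 2 * (m * y + 1)"
  shows "of_nat (fact k) * motzkin b l 0 n k = ed_array m y n k"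
proof (induction n arbitrary: k)
  case 0
  show ?case by (cases k) (simp_all add: ed_array_def ed_term_def dowling_whitney_def)
next
  case (Suc n)
  show ?case
  proof (cases k)
    case 0
    then show ?thesis
      using Suc.IH[of 0] Suc.IH[of 1] by (simp add: b l ed_array_recurrence_0)
  next
    case (Suc k')
    have "of_nat (fact k) * motzkin b l 0 (Suc n) k
        = of_nat (Suc k') * (of_nat (fact k') * motzkin b l 0 n k')
          + (y + 1 + of_nat (Suc k') * (m * y + 2)) * (of_nat (fact k) * motzkin b l 0 n k)
          + of_nat (Suc (Suc k')) * (m * y + 1) * (of_nat (fact (Suc k)) * motzkin b l 0 n (Suc k))"
      unfolding Suc by (simp add: b l power2_eq_square algebra_simps)
    also have "\<dots> = ed_array m y (Suc n) k"
      unfolding Suc.IH unfolding Suc ed_array_recurrence_Suc ..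
    finally show ?thesis .
  qed
qed

section \<open>Specialization to polynomials in x, with y = x - 1\<close>

lemma const_poly_dowling_whitney: "[:dowling_whitney m n k:] = dowling_whitney [:m:] n k"
proof -
  have sum: "[:sum f S:] = (\<Sum>i\<in>S. [:f i:])" for f :: "nat \<Rightarrow> 'a" and S
    by (rule poly_eqI) (simp add: coeff_sum coeff_pCons split: nat.split)
  have pow: "[:m:] ^ i = [:m ^ i:]" for i
    by (induction i) simp_all
  show ?thesis
    unfolding dowling_whitney_def sum
    by (intro sum.cong) (simp_all add: pow of_nat_poly)
qed

lemma eulerian_dowling_eq_ed_array: "eulerian_dowling m n = ed_array [:m:] ([:0, 1:] - 1) n 0"
  unfolding eulerian_dowling_def ed_array_def ed_term_def const_poly_dowling_whitney
  by (simp add: atMost_atLeast0)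

lemma prod_of_nat_squares:
  "(\<Prod>p=1..k. of_nat p ^ 2 * c) = (of_nat (fact k) ^ 2 * c ^ k :: 'a::comm_ring_1)"
  by (simp only: prod.distrib fact_prod of_nat_prod prod_power_distrib) simp

lemma prod_power_triangle: "(\<Prod>k=0..n. c ^ k) = (c ^ ((n + 1) choose 2) :: 'a::comm_ring_1)"
  by (induction n) (simp_all add: numeral_2_eq_2 power_add mult_ac)

theorem mainTheorem4:
  fixes m :: complex and x :: "complex poly"
    and b l :: "nat \<Rightarrow> complex poly"
  defines "x \<equiv> [:0, 1:]"
    and "b \<equiv> (\<lambda>n. x * (of_nat n * [:m:] + 1) - of_nat n * ([:m:] - 2))"
    and "l \<equiv> (\<lambda>n. of_nat n ^ 2 * ([:m:] * (x - 1) + 1))"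
  shows "has_jfraction (Abs_fps (eulerian_dowling m)) b l \<and>
    (\<forall>n. hankel_transform (eulerian_dowling m) n =
       ([:m:] * (x - 1) + 1) ^ ((n + 1) choose 2) * (\<Prod>k=0..n. (of_nat (fact k)) ^ 2))"
proof -
  \<comment> \<open>Regrouped in powers of \<open>x - 1\<close> to match the path weights with y = x
    - 1.\<close>
  have b: "b n = (x - 1) + 1 + of_nat n * ([:m:] * (x - 1) + 2)" for n
    unfolding b_def by (simp only: algebra_simps) simp
  have l: "l n = of_nat n ^ 2 * ([:m:] * (x - 1) + 1)" for n
    by (simp add: l_def)
  have moments: "eulerian_dowling m = (\<lambda>n. motzkin b l 0 n 0)"
    using fact_motzkin_eq_ed_array[of b "x - 1" "[:m:]" l 0, OF b l]
    by (simp add: eulerian_dowling_eq_ed_array x_def fun_eq_iff)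
  have "(\<Prod>k=0..n. \<Prod>p=1..k. l p)
      = ([:m:] * (x - 1) + 1) ^ ((n + 1) choose 2) * (\<Prod>k=0..n. (of_nat (fact k)) ^ 2)" for n
    unfolding l prod_of_nat_squares unfolding prod.distrib prod_power_triangle by (rule mult.commute)
  then show ?thesis
    unfolding moments by (simp add: has_jfraction_motzkin hankel_transform_motzkin)
qed

end
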